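(* Let $I$ be a minimal ideal of a finite-dimensional algebra $A$ over a field $\mathbb{K}$. Suppose that there exists $\mathcal{E}\subseteq\mathcal{P}(\operatorname{idem}(A))\smallsetminus\{\emptyset\}$ such that $$T:=\bigl(I\cap\operatorname{sumspan}(\mathcal{E},\operatorname{autolann}(\mathcal{E}))\bigr)\smallsetminus\{0\}\neq\emptyset.$$ Then every element of $T$ is an idempotent generating $I$ (as an ideal of $A$).
   Context: An algebra is a vector space with a bilinear multiplication (not necessarily associative or commutative). "Ideal" means two-sided ideal. A minimal ideal of $A$ is a non-zero ideal $I$ such that every non-zero ideal $J\subseteq I$ of $A$ equals $I$. An element $e$ is idempotent if $e^2=e$; $\operatorname{idem}(A):=\{e\in A\mid e^2=e\neq 0\}$. $\mathcal{P}(X)$ is the power set of $X$. For a set $\mathcal{E}$ of non-empty subsets of $A$, the left autoannihilator for products of $\mathcal{E}$ is $$\operatorname{autolann}(\mathcal{E})=\bigcup_{E\in\mathcal{E}}\{e\in E\mid eF=\{0\}\text{ for all }F\in\mathcal{E}\text{ with }F\neq E\}.$$ For $E\subseteq A$ and $n\in\mathbb{N}$, $\operatorname{sumspan}(\mathcal{E},E,n)$ is the set of sums $\sum_{i=1}^n e_i$ with $e_1,\dots,e_n\in E$ such that for every $F\in\mathcal{E}$ there is at most one index $i\in\{1,\dots,n\}$ with $e_i\in F$; and $\operatorname{sumspan}(\mathcal{E},E):=\bigcup_{n\in\mathbb{N}}\operatorname{sumspan}(\mathcal{E},E,n)$. *)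

theory Defs
  imports Complex_Main
begin

locale nonassoc_algebra = vector_space scale
  for scale :: "'k::field \<Rightarrow> 'a::ab_group_add \<Rightarrow> 'a" +
  fixes mul :: "'a \<Rightarrow> 'a \<Rightarrow> 'a"
  assumes linear_mul_left: "Vector_Spaces.linear scale scale (\<lambda>y. mul x y)"
    and linear_mul_right: "Vector_Spaces.linear scale scale (\<lambda>x. mul x y)"

locale fin_dim_nonassoc_algebra = nonassoc_algebra scale mul
  for scale :: "'k::field \<Rightarrow> 'a::ab_group_add \<Rightarrow> 'a" and mul +
  assumes fin_dim: "\<exists>Basis. finite_dimensional_vector_space scale Basis"

definition alg_ideal ::
    "('k::field \<Rightarrow> 'a::ab_group_add \<Rightarrow> 'a) \<Rightarrow> ('a \<Rightarrow> 'a \<Rightarrow> 'a) \<Rightarrow> 'a set \<Rightarrow> bool" where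
  "alg_ideal scale mul I \<longleftrightarrow>
     module.subspace scale I \<and> (\<forall>a. \<forall>x\<in>I. mul a x \<in> I \<and> mul x a \<in> I)"

definition minimal_ideal ::
    "('k::field \<Rightarrow> 'a::ab_group_add \<Rightarrow> 'a) \<Rightarrow> ('a \<Rightarrow> 'a \<Rightarrow> 'a) \<Rightarrow> 'a set \<Rightarrow> bool" where
  "minimal_ideal scale mul I \<longleftrightarrow>
     alg_ideal scale mul I \<and> I \<noteq> {0} \<and>
     (\<forall>J. alg_ideal scale mul J \<and> J \<noteq> {0} \<and> J \<subseteq> I \<longrightarrow> J = I)"

definition generated_ideal ::
    "('k::field \<Rightarrow> 'a::ab_group_add \<Rightarrow> 'a) \<Rightarrow> ('a \<Rightarrow> 'a \<Rightarrow> 'a) \<Rightarrow> 'a set \<Rightarrow> 'a set" where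
  "generated_ideal scale mul S = alg_ideal scale mul hull S"

definition idempotent_elem :: "('a \<Rightarrow> 'a \<Rightarrow> 'a) \<Rightarrow> 'a \<Rightarrow> bool" where
  "idempotent_elem mul e \<longleftrightarrow> mul e e = e"

text \<open>Only the non-zero idempotents are collected here, while
  \<^const>\<open>idempotent_elem\<close> also holds for zero.\<close>

definition idem_set :: "('a::zero \<Rightarrow> 'a \<Rightarrow> 'a) \<Rightarrow> 'a set" where
  "idem_set mul = {e. idempotent_elem mul e \<and> e \<noteq> 0}"

definition autolann :: "('a::zero \<Rightarrow> 'a \<Rightarrow> 'a) \<Rightarrow> 'a set set \<Rightarrow> 'a set" where
  "autolann mul \<E> = (\<Union>E\<in>\<E>. {e \<in> E. \<forall>F\<in>\<E>. F \<noteq> E \<longrightarrow> mul e ` F = {0}})"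

definition sumspan_n :: "'a::comm_monoid_add set set \<Rightarrow> 'a set \<Rightarrow> nat \<Rightarrow> 'a set" where
  "sumspan_n \<E> E n =
     {\<Sum>i=1..n. e i | e. (\<forall>i\<in>{1..n}. e i \<in> E) \<and>
        (\<forall>F\<in>\<E>. \<exists>\<^sub>\<le>\<^sub>1i. i \<in> {1..n} \<and> e i \<in> F)}"

text \<open>The length 0 is allowed, so the empty sum 0 always belongs to the following set.\<close>

definition sumspan :: "'a::comm_monoid_add set set \<Rightarrow> 'a set \<Rightarrow> 'a set" where
  "sumspan \<E> E = (\<Union>n. sumspan_n \<E> E n)"

end

theory Submission
  imports Defs
begin

text \<open>Left autoannihilators lying in distinct members of \<open>\<E>\<close> multiply to zero, so the summands of an
  element of \<open>T\<close> are pairwise orthogonal idempotents and their sum is an idempotent. Any non-zero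
  element of a minimal ideal generates it.\<close>

text \<open>Closure under intersection is what makes the hull in \<open>generated_ideal\<close> an
  ideal itself.\<close>

lemma alg_ideal_Inter:
  assumes "vector_space scale" and "\<And>J. J \<in> \<J> \<Longrightarrow> alg_ideal scale mul J"
  shows "alg_ideal scale mul (\<Inter>\<J>)"
proof -
  interpret vector_space scale by fact
  show ?thesis
    using assms(2) unfolding alg_ideal_def by (auto intro!: subspace_Inter)
qed

lemma alg_ideal_generated_ideal:
  assumes "vector_space scale"
  shows "alg_ideal scale mul (generated_ideal scale mul S)"
  unfolding generated_ideal_def
  by (rule hull_in) (simp add: alg_ideal_Inter assms)

text \<open>The hull of \<open>{x}\<close> is an ideal inside \<open>I\<close>, and it is non-zero
  because it contains \<open>x\<close>; minimality then forces equality.\<close>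

lemma generated_ideal_minimal_ideal:
  assumes "vector_space scale" and I: "minimal_ideal scale mul I" and x: "x \<in> I" "x \<noteq> 0"
  shows "generated_ideal scale mul {x} = I"
proof -
  let ?J = "generated_ideal scale mul {x}"
  have "x \<in> ?J"
    unfolding generated_ideal_def by (rule hull_inc) simp
  moreover have "?J \<subseteq> I"
    unfolding generated_ideal_def
    by (rule hull_minimal) (use I x in \<open>auto simp: minimal_ideal_def\<close>)
  ultimately show ?thesis
    using alg_ideal_generated_ideal[OF assms(1)] I x(2) unfolding minimal_ideal_def by blast
qed

context nonassoc_algebra
begin

lemma mul_sum_left: "mul (\<Sum>i\<in>A. f i) y = (\<Sum>i\<in>A. mul (f i) y)"
proof -
  \<comment> \<open>\<open>linear_mul_right\<close> concerns right multiplication by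
    \<open>y\<close>, hence linearity in the left factor.\<close>
  interpret Vector_Spaces.linear scale scale "\<lambda>x. mul x y" by (rule linear_mul_right)
  show ?thesis by (rule sum)
qed

lemma mul_sum_right: "mul x (\<Sum>i\<in>A. f i) = (\<Sum>i\<in>A. mul x (f i))"
proof -
  interpret Vector_Spaces.linear scale scale "\<lambda>y. mul x y" by (rule linear_mul_left)
  show ?thesis by (rule sum)
qed

lemma idempotent_elem_sum_orthogonal:
  assumes "finite A" and idem: "\<And>i. i \<in> A \<Longrightarrow> idempotent_elem mul (e i)"
    and orth: "\<And>i j. i \<in> A \<Longrightarrow> j \<in> A \<Longrightarrow> i \<noteq> j \<Longrightarrow> mul (e i) (e j) = 0"
  shows "idempotent_elem mul (\<Sum>i\<in>A. e i)"
proof -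
  have "mul (\<Sum>i\<in>A. e i) (\<Sum>j\<in>A. e j) = (\<Sum>i\<in>A. \<Sum>j\<in>A. mul (e i) (e j))"
    \<comment> \<open>Expanding the left factor first fixes the order of the double sum:
      \<open>i\<close> outside, \<open>j\<close> inside.\<close>
    by (subst mul_sum_left) (simp only: mul_sum_right)
  also have "\<dots> = (\<Sum>i\<in>A. \<Sum>j\<in>A. if i = j then e i else 0)"
    using idem orth by (intro sum.cong refl) (auto simp: idempotent_elem_def)
  also have "\<dots> = (\<Sum>i\<in>A. e i)"
    using \<open>finite A\<close> by simp
  finally show ?thesis
    unfolding idempotent_elem_def .
qed

text \<open>The empty sum causes no exception, since \<open>idempotent_elem\<close> holds for
  0.\<close>

lemma idempotent_elem_sumspan_autolann:
  assumes \<E>: "\<E> \<subseteq> Pow (idem_set mul)" and x: "x \<in> sumspan \<E> (autolann mul \<E>)"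
  shows "idempotent_elem mul x"
proof -
  from x obtain n where "x \<in> sumspan_n \<E> (autolann mul \<E>) n"
    unfolding sumspan_def by blast
  then obtain e where x_eq: "x = (\<Sum>i=1..n. e i)"
    and e: "\<forall>i\<in>{1..n}. e i \<in> autolann mul \<E>"
    and uniq: "\<forall>F\<in>\<E>. \<exists>\<^sub>\<le>\<^sub>1i. i \<in> {1..n} \<and> e i \<in> F"
    unfolding sumspan_n_def by blast
  have "mul (e i) (e j) = 0" if ij: "i \<in> {1..n}" "j \<in> {1..n}" "i \<noteq> j" for i j
  proof -
    obtain E where E: "E \<in> \<E>" "e i \<in> E"
      and ann: "\<And>F. F \<in> \<E> \<Longrightarrow> F \<noteq> E \<Longrightarrow> mul (e i) ` F = {0}"
      using bspec[OF e ij(1)] unfolding autolann_def by blast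
    obtain F where F: "F \<in> \<E>" "e j \<in> F"
      using bspec[OF e ij(2)] unfolding autolann_def by blast
    \<comment> \<open>If \<open>F = E\<close>, then \<open>E\<close> would contain summands at the
      two distinct indices \<open>i\<close> and \<open>j\<close>, against \<open>uniq\<close>. This
      counts indices, so it also covers \<open>e i = e j\<close>.\<close>
    have "F \<noteq> E"
      using bspec[OF uniq E(1)] E(2) F(2) ij unfolding Uniq_def by blast
    with ann[OF F(1)] F(2) show ?thesis by blast
  qed
  \<comment> \<open>Each \<open>e i\<close> lies in some member of \<open>\<E>\<close>, and these
    members consist of idempotents.\<close>
  moreover have "idempotent_elem mul (e i)" if "i \<in> {1..n}" for i
    using bspec[OF e that] \<E> unfolding autolann_def idem_set_def by blast
  ultimately show ?thesis
    unfolding x_eq by (intro idempotent_elem_sum_orthogonal) auto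
qed

end

theorem theorem75:
  fixes scale :: "'k::field \<Rightarrow> 'a::ab_group_add \<Rightarrow> 'a"
    and mul :: "'a \<Rightarrow> 'a \<Rightarrow> 'a"
    and I :: "'a set" and \<E> :: "'a set set" and T :: "'a set"
  assumes "fin_dim_nonassoc_algebra scale mul"
    and "minimal_ideal scale mul I"
    and "\<E> \<subseteq> Pow (idem_set mul) - {{}}"
    and "T = (I \<inter> sumspan \<E> (autolann mul \<E>)) - {0}"
    and "T \<noteq> {}"
  shows "\<forall>x\<in>T. idempotent_elem mul x \<and> generated_ideal scale mul {x} = I"
proof
  fix x assume "x \<in> T"
  \<comment> \<open>Membership in \<open>sumspan\<close> yields idempotency;
    \<open>x \<in> I\<close> and \<open>x \<noteq> 0\<close> yield generation.\<close>
  then have x: "x \<in> I" "x \<noteq> 0" "x \<in> sumspan \<E> (autolann mul \<E>)"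
    using assms(4) by auto
  interpret fin_dim_nonassoc_algebra scale mul by fact
  show "idempotent_elem mul x \<and> generated_ideal scale mul {x} = I"
    using idempotent_elem_sumspan_autolann[of \<E> x] assms(3) x(3)
      generated_ideal_minimal_ideal[OF vector_space_axioms assms(2) x(1,2)] by blast
qed

end
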